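(* Let $n\ge1$. 1. The set of functions in $C(\partial B^n)$ that are holomorphically extendable from one side in the separately continuous sense at no point of $\partial B^n$ is a dense $G_\delta$ subset of $C(\partial B^n)$. 2. The set of functions in $C(\partial B^n)$ that are holomorphically extendable from one side (in the usual sense) at no point of $\partial B^n$ is residual in $C(\partial B^n)$, i.e. it contains a dense $G_\delta$ subset. 3. The set of functions in $C(\partial B^n)$ that are holomorphically extendable from one side in the Lipschitz continuous sense at no point of $\partial B^n$ is a dense $G_\delta$ subset of $C(\partial B^n)$.
   Context: $B^n$ is the open Euclidean unit ball of $\mathbb{C}^n$. $C(\partial B^n)$ is the Banach space of continuous functions $\partial B^n\to\mathbb{C}$ with the supremum norm. A function $f:\partial B^n\to\mathbb{C}$ is holomorphically extendable from one side (usual sense) at $\zeta\in\partial B^n$ if there are an open neighborhood $U\subseteq\mathbb{C}^n$ of $\zeta$ and a continuous function $F:[U\cap B^n]\cup\partial B^n\to\mathbb{C}$ that is holomorphic on $U\cap B^n$ and agrees with $f$ on $\partial B^n$. In the separately continuous sense, the continuity of $F$ is relaxed to: $F$ is bounded and separately continuous, i.e. continuous in each complex variable when the other variables are fixed. In the Lipschitz continuous sense, the continuity of $F$ is strengthened to Lipschitz continuity of $F$. *)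

theory Defs
  imports "HOL-Analysis.Analysis"
begin

text \<open>
  Functions are total in HOL; everything below depends only on the values of a function on the
  set mentioned. The norm of \<^typ>\<open>complex^'n\<close> is the Euclidean one, so \<^term>\<open>ball 0 1\<close> and
  \<^term>\<open>sphere 0 1\<close> are the open unit ball of complex \<open>n\<close>-space and its boundary.
\<close>

text \<open>Holomorphic on an open set: the real Frechet derivative exists and is complex linear.\<close>

definition holomorphic_several_on :: "(complex^'n \<Rightarrow> complex) \<Rightarrow> (complex^'n) set \<Rightarrow> bool" where
  "holomorphic_several_on F S \<longleftrightarrow>
     (\<forall>z\<in>S. \<exists>D. (F has_derivative D) (at z) \<and> (\<forall>c v. D (c *s v) = c * D v))"

definition separately_continuous_on :: "(complex^'n) set \<Rightarrow> (complex^'n \<Rightarrow> complex) \<Rightarrow> bool" where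
  "separately_continuous_on S F \<longleftrightarrow>
     (\<forall>z\<in>S. \<forall>i. continuous_on {w. (\<chi> j. if j = i then w else z $ j) \<in> S}
        (\<lambda>w. F (\<chi> j. if j = i then w else z $ j)))"

text \<open>
  The common part of the three notions of one-sided extendability of \<open>f\<close> at \<open>\<zeta>\<close>; the predicate
  \<open>R\<close> is the regularity required of the extension \<open>F\<close> on its whole domain.
\<close>

definition one_sided_extendable_with ::
  "((complex^'n) set \<Rightarrow> (complex^'n \<Rightarrow> complex) \<Rightarrow> bool) \<Rightarrow>
     (complex^'n \<Rightarrow> complex) \<Rightarrow> complex^'n \<Rightarrow> bool" where
  "one_sided_extendable_with R f \<zeta> \<longleftrightarrow>
     (\<exists>U F. open U \<and> \<zeta> \<in> U \<and>
        R ((U \<inter> ball 0 1) \<union> sphere 0 1) F \<and>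
        holomorphic_several_on F (U \<inter> ball 0 1) \<and>
        (\<forall>z\<in>sphere 0 1. F z = f z))"

definition one_sided_extendable :: "(complex^'n \<Rightarrow> complex) \<Rightarrow> complex^'n \<Rightarrow> bool" where
  "one_sided_extendable = one_sided_extendable_with continuous_on"

definition one_sided_extendable_separately :: "(complex^'n \<Rightarrow> complex) \<Rightarrow> complex^'n \<Rightarrow> bool" where
  "one_sided_extendable_separately =
     one_sided_extendable_with (\<lambda>S F. bounded (F ` S) \<and> separately_continuous_on S F)"

definition one_sided_extendable_Lipschitz :: "(complex^'n \<Rightarrow> complex) \<Rightarrow> complex^'n \<Rightarrow> bool" where
  "one_sided_extendable_Lipschitz =
     one_sided_extendable_with (\<lambda>S F. \<exists>L. L-lipschitz_on S F)"

text \<open>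
  The space of continuous functions on the sphere with the supremum metric. As the sphere is compact,
  the boundedness built into \<^const>\<open>cfunspace\<close> is automatic. Its elements are extensional, so that
  functions agreeing on the sphere are equal.
\<close>

definition sphere_cfunspace :: "(complex^'n \<Rightarrow> complex) metric" where
  "sphere_cfunspace = cfunspace (top_of_set (sphere 0 1)) euclidean_metric"

definition dense_in :: "'a topology \<Rightarrow> 'a set \<Rightarrow> bool" where
  "dense_in X S \<longleftrightarrow> S \<subseteq> topspace X \<and> X closure_of S = topspace X"

definition dense_gdelta_in :: "'a topology \<Rightarrow> 'a set \<Rightarrow> bool" where
  "dense_gdelta_in X S \<longleftrightarrow> gdelta_in X S \<and> dense_in X S"

definition residual_in :: "'a topology \<Rightarrow> 'a set \<Rightarrow> bool" where
  "residual_in X S \<longleftrightarrow> S \<subseteq> topspace X \<and> (\<exists>G. G \<subseteq> S \<and> dense_gdelta_in X G)"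

definition nowhere_on_sphere ::
  "((complex^'n \<Rightarrow> complex) \<Rightarrow> complex^'n \<Rightarrow> bool) \<Rightarrow> (complex^'n \<Rightarrow> complex) set" where
  "nowhere_on_sphere E = {f \<in> mspace sphere_cfunspace. \<forall>\<zeta>\<in>sphere 0 1. \<not> E f \<zeta>}"

lemma mspace_sphere_cfunspace:
  "mspace (sphere_cfunspace :: (complex^'n \<Rightarrow> complex) metric) =
     {f \<in> extensional (sphere 0 1). continuous_on (sphere 0 1) f}"
proof -
  have "compact (f ` sphere 0 1)" if "continuous_on (sphere 0 1) f" for f :: "complex^'n \<Rightarrow> complex"
    using that by (intro compact_continuous_image) auto
  then show ?thesis
    by (auto simp: sphere_cfunspace_def compact_imp_bounded)
qed

lemma mdist_sphere_cfunspace: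
  fixes f g :: "complex^'n \<Rightarrow> complex"
  assumes "f \<in> mspace sphere_cfunspace" "g \<in> mspace sphere_cfunspace"
  shows "mdist sphere_cfunspace f g = (SUP z\<in>sphere 0 1. norm (f z - g z))"
proof -
  have "axis undefined 1 \<in> sphere (0 :: complex^'n) 1"
    by simp
  then have "sphere (0 :: complex^'n) 1 \<noteq> {}"
    by blast
  with assms show ?thesis
    by (simp add: sphere_cfunspace_def cfunspace_def Metric_space.fdist_def dist_norm
        Met_TC.fdist_def)
qed

end

theory Submission
  imports Defs "HOL-Complex_Analysis.Conformal_Mappings" "HOL-Real_Asymp.Real_Asymp"
begin

text \<open>
  The functions that are extendable somewhere form a meagre set, and, for the separately continuous and the
  Lipschitz notion, an \<open>F\<^sub>\<sigma>\<close> set. Small neighbourhoods of boundary points are described by caps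
  \<open>{z. c < z \<bullet> p}\<close>. By shrinking, a function that is extendable somewhere has an extension to a cap whose pole \<open>p\<close>
  lies in a fixed countable dense subset of the sphere, with an integer bound on its modulus (and its Lipschitz
  constant). These are countably many sets of functions, so two facts are to be shown.

  The first is that passing to the closure of such a set costs at most a slightly smaller cap
  (\<open>closure_extendable_to_cap\<close>). It rests on \<open>cap_estimate\<close>: a bounded holomorphic function that is
  small on the spherical part of a cap is small on each smaller cap. The estimate is the maximum principle
  on one-dimensional slices, with the weight \<open>exp (N * \<Sum>j. z\<^sub>j cnj p\<^sub>j)\<close>. So uniform convergence on
  the sphere forces uniform convergence of bounded extensions up to the sphere, and the limit is
  holomorphic by Weierstrass' theorem (\<open>holomorphic_several_uniform_limit\<close>).

  The second is that the sets have empty interior (\<open>interior_extendable_to_cap\<close>). As extendability is a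
  linear condition, one continuous function that does not extend to the cap is enough. The one used
  vanishes on one side of \<open>p\<close> and is positive on the other, along a circle in the sphere; by the identity
  theorem its extension would vanish on both sides (\<open>witness_not_extendable\<close>).

  Baire's theorem then gives the separately continuous and the Lipschitz case
  (\<open>dense_gdelta_nowhere_extendable\<close>). The usual notion implies the separately continuous one, so its
  exceptional set contains the dense \<open>G\<^sub>\<delta>\<close> set of the separately continuous case.
\<close>

section \<open>Holomorphic functions of several variables along complex lines\<close>

lemma bounded_linear_complex_line: "bounded_linear (\<lambda>t. t *s (v :: complex^'n))"
  by (simp add: linear_conv_bounded_linear [symmetric] linear_iff vec_eq_iff
      algebra_simps scaleR_conv_of_real[where 'a = complex])

lemma norm_scale_complex: "norm (t *s (v :: complex^'n)) = norm t * norm v"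
  by (simp add: norm_vec_def L2_set_def norm_mult power_mult_distrib sum_distrib_left [symmetric]
      real_sqrt_mult)

lemma has_field_derivative_complex_line:
  fixes F :: "complex^'n \<Rightarrow> complex"
  assumes F: "(F has_derivative D) (at (a + t *s v))" and D: "\<And>c v. D (c *s v) = c * D v"
  shows "((\<lambda>t. F (a + t *s v)) has_field_derivative D v) (at t)"
proof -
  have "((\<lambda>t. a + t *s v) has_derivative (\<lambda>t. t *s v)) (at t)"
    by (auto intro!: derivative_eq_intros bounded_linear.has_derivative[OF bounded_linear_complex_line])
  from has_derivative_compose[OF this F]
  show ?thesis
    by (simp add: has_field_derivative_def D mult_commute_abs)
qed

lemma holomorphic_on_complex_line:
  assumes "holomorphic_several_on F S"
  shows "(\<lambda>t. F (a + t *s v)) holomorphic_on {t. a + t *s v \<in> S}"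
proof -
  have "(\<lambda>t. F (a + t *s v)) field_differentiable at t within {t. a + t *s v \<in> S}" 
    if t: "a + t *s v \<in> S" for t
  proof -
    obtain D where "(F has_derivative D) (at (a + t *s v))" "\<And>c v. D (c *s v) = c * D v"
      using assms t unfolding holomorphic_several_on_def by metis
    from has_field_derivative_complex_line[OF this] show ?thesis
      using field_differentiable_at_within field_differentiable_def by blast
  qed
  then show ?thesis
    by (simp add: holomorphic_on_def)
qed

lemma holomorphic_several_on_diff:
  assumes "holomorphic_several_on F S" "holomorphic_several_on G S"
  shows "holomorphic_several_on (\<lambda>z. F z - G z) S"
  unfolding holomorphic_several_on_def
proof
  fix z assume z: "z \<in> S"
  obtain D where D: "(F has_derivative D) (at z)" "\<And>c v. D (c *s v) = c * D v"
    using assms z unfolding holomorphic_several_on_def by metis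
  obtain E where E: "(G has_derivative E) (at z)" "\<And>c v. E (c *s v) = c * E v"
    using assms z unfolding holomorphic_several_on_def by metis
  show "\<exists>D. ((\<lambda>z. F z - G z) has_derivative D) (at z) \<and> (\<forall>c v. D (c *s v) = c * D v)"
    using has_derivative_diff[OF D(1) E(1)] D(2) E(2)
    by (intro exI[of _ "\<lambda>v. D v - E v"]) (auto simp: right_diff_distrib)
qed

lemma holomorphic_several_on_cmult:
  assumes "holomorphic_several_on F S"
  shows "holomorphic_several_on (\<lambda>z. a * F z) S"
  unfolding holomorphic_several_on_def
proof
  fix z assume z: "z \<in> S"
  obtain D where D: "(F has_derivative D) (at z)" "\<And>c v. D (c *s v) = c * D v"
    using assms z unfolding holomorphic_several_on_def by metis
  show "\<exists>D. ((\<lambda>z. a * F z) has_derivative D) (at z) \<and> (\<forall>c v. D (c *s v) = c * D v)"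
    using has_derivative_mult_right[OF D(1), of a] D(2)
    by (intro exI[of _ "\<lambda>v. a * D v"]) auto
qed

lemma holomorphic_several_on_subset:
  "holomorphic_several_on F S \<Longrightarrow> T \<subseteq> S \<Longrightarrow> holomorphic_several_on F T"
  unfolding holomorphic_several_on_def by blast

text \<open>
  The Cauchy estimate for several variables. The derivative in direction \<open>v\<close> is the derivative at
  \<open>0\<close> of the restriction of \<open>F\<close> to the complex line through \<open>z\<close> in direction \<open>v\<close>, so the estimate in
  one variable on a disc of radius \<open>s / norm v\<close> suffices.
\<close>

lemma complex_linear_derivative_bound:
  fixes F :: "complex^'n \<Rightarrow> complex"
  assumes hol: "holomorphic_several_on F (ball z r)" and "s < r" "0 < s"
    and B: "\<And>x. x \<in> ball z r \<Longrightarrow> norm (F x) \<le> B"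
    and D: "(F has_derivative D) (at z)" "\<And>c v. D (c *s v) = c * D v"
  shows "norm (D v) \<le> B / s * norm v"
proof (cases "v = 0")
  case True
  have "D 0 = 0" using D(2)[of 0 0] by simp
  with True show ?thesis by simp
next
  case False
  define t where "t = s / norm v"
  have t: "t > 0" using False \<open>0 < s\<close> by (simp add: t_def)
  let ?f = "\<lambda>w. F (z + w *s v)"
  have sub: "z + w *s v \<in> ball z r" if "norm w \<le> t" for w
  proof -
    have "norm w * norm v \<le> s"
      using that False by (simp add: t_def field_simps)
    then show ?thesis using \<open>s < r\<close> by (simp add: dist_norm norm_scale_complex)
  qed
  have h: "?f holomorphic_on cball 0 t"
    by (rule holomorphic_on_subset[OF holomorphic_on_complex_line[OF hol]]) (use sub in auto)
  have "norm ((deriv ^^ 1) ?f 0) \<le> fact 1 * B / t ^ 1"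
  proof (rule Cauchy_inequality)
    show "?f holomorphic_on ball 0 t"
      using h by (rule holomorphic_on_subset) auto
    show "continuous_on (cball 0 t) ?f" using h by (rule holomorphic_on_imp_continuous_on)
  qed (use t sub B in auto)
  moreover have "deriv ?f 0 = D v"
    using has_field_derivative_complex_line[of F D z 0 v] D by (intro DERIV_imp_deriv) simp
  ultimately show ?thesis by (simp add: t_def)
qed

text \<open>
  Weierstrass' theorem for several variables. By the Cauchy estimate, applied to differences of the
  functions, the derivatives are uniformly Cauchy near each point; so they converge, and their limit is
  the derivative of the limit function. Complex linearity passes to the limit.
\<close>

lemma holomorphic_several_uniform_limit:
  fixes F :: "nat \<Rightarrow> complex^'n \<Rightarrow> complex"
  assumes "open S" and hol: "\<And>n. holomorphic_several_on (F n) S"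
    and lim: "uniform_limit S F G sequentially"
  shows "holomorphic_several_on G S"
  unfolding holomorphic_several_on_def
proof
  fix z assume "z \<in> S"
  then obtain r where r: "r > 0" "ball z r \<subseteq> S"
    using \<open>open S\<close> openE by blast
  define s where "s = r / 3"
  have s: "0 < s" using r by (simp add: s_def)
  have "\<forall>n. \<forall>x\<in>S. \<exists>D. (F n has_derivative D) (at x) \<and> (\<forall>c v. D (c *s v) = c * D v)"
    using hol unfolding holomorphic_several_on_def by blast
  then obtain D where D: "\<And>n x. x \<in> S \<Longrightarrow> (F n has_derivative D n x) (at x)"
     "\<And>n x c v. x \<in> S \<Longrightarrow> D n x (c *s v) = c * D n x v"
    by metis
  have sub: "ball x (2 * s) \<subseteq> S" if "x \<in> ball z s" for x
  proof -
    have "ball x (2 * s) \<subseteq> ball z r"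
      using that by (simp add: s_def subset_iff) (smt (verit) dist_triangle)
    with r show ?thesis by blast
  qed
  have inS: "x \<in> S" if "x \<in> ball z s" for x
    using sub[OF that] s by auto
  have cauchy: "\<exists>N. \<forall>m\<ge>N. \<forall>n\<ge>N. \<forall>x\<in>ball z s. \<forall>v. norm (D m x v - D n x v) \<le> e * norm v"
    if e: "e > 0" for e
  proof -
    have "uniformly_Cauchy_on S F"
      using lim uniformly_convergent_eq_Cauchy uniformly_convergent_on_def by blast
    then obtain N where N: "\<And>x m n. x \<in> S \<Longrightarrow> m \<ge> N \<Longrightarrow> n \<ge> N \<Longrightarrow> dist (F m x) (F n x) < e * s"
      unfolding uniformly_Cauchy_on_def using e s by (metis mult_pos_pos)
    have "norm (D m x v - D n x v) \<le> e * norm v" if "m \<ge> N" "n \<ge> N" "x \<in> ball z s" for m n x v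
    proof -
      have "norm ((\<lambda>v. D m x v - D n x v) v) \<le> (e * s) / s * norm v"
      proof (rule complex_linear_derivative_bound)
        show "holomorphic_several_on (\<lambda>y. F m y - F n y) (ball x (2 * s))"
          using holomorphic_several_on_diff[OF hol hol] sub[OF that(3)]
          by (rule holomorphic_several_on_subset)
        show "((\<lambda>y. F m y - F n y) has_derivative (\<lambda>v. D m x v - D n x v)) (at x)"
          using D(1) inS[OF that(3)] by (intro has_derivative_diff) auto
        show "D m x (c *s v) - D n x (c *s v) = c * (D m x v - D n x v)" for c v
          using D(2) inS[OF that(3)] by (simp add: right_diff_distrib)
        show "norm (F m y - F n y) \<le> e * s" if "y \<in> ball x (2 * s)" for y
          using N[of y m n] that sub[OF \<open>x \<in> ball z s\<close>] \<open>m \<ge> N\<close> \<open>n \<ge> N\<close> by (auto simp: dist_norm)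
      qed (use s in auto)
      with s show ?thesis by simp
    qed
    then show ?thesis by blast
  qed
  \<comment> \<open>The pointwise limit of the derivatives is the candidate for the derivative of the limit.\<close>
  define D' where "D' = (\<lambda>x v. lim (\<lambda>n. D n x v))"
  have D': "(\<lambda>n. D n x v) \<longlonglongrightarrow> D' x v" if x: "x \<in> ball z s" for x v
  proof -
    have "Cauchy (\<lambda>n. D n x v)"
    proof (rule metric_CauchyI)
      fix e :: real assume "e > 0"
      then have "e / (norm v + 1) > 0" by (simp add: add_nonneg_pos)
      from cauchy[OF this] obtain N where N: "\<And>m n. m \<ge> N \<Longrightarrow> n \<ge> N \<Longrightarrow>
          norm (D m x v - D n x v) \<le> e / (norm v + 1) * norm v"
        using x by blast
      have "e / (norm v + 1) * norm v < e"
        using \<open>e > 0\<close> by (simp add: pos_divide_less_eq add_nonneg_pos distrib_left)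
      then show "\<exists>M. \<forall>m\<ge>M. \<forall>n\<ge>M. dist (D m x v) (D n x v) < e"
        using N by (intro exI[of _ N]) (auto simp: dist_norm intro: le_less_trans)
    qed
    then show ?thesis
      unfolding D'_def using Cauchy_convergent_iff convergent_LIMSEQ_iff by blast
  qed
  have "\<exists>g. \<forall>x\<in>ball z s. (\<lambda>n. F n x) \<longlonglongrightarrow> g x \<and> (g has_derivative D' x) (at x within ball z s)"
  proof (rule has_derivative_sequence)
    show "(F n has_derivative D n x) (at x within ball z s)" if "x \<in> ball z s" for n x
      using D(1) inS[OF that] has_derivative_at_withinI by blast
    show "\<forall>\<^sub>F n in sequentially. \<forall>x\<in>ball z s. \<forall>h. norm (D n x h - D' x h) \<le> e * norm h"
      if e: "e > 0" for e
    proof -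
      obtain N where N: "\<And>m n x v. m \<ge> N \<Longrightarrow> n \<ge> N \<Longrightarrow> x\<in>ball z s \<Longrightarrow>
           norm (D m x v - D n x v) \<le> e * norm v"
        using cauchy[OF e] by blast
      have "norm (D m x v - D' x v) \<le> e * norm v" if "m \<ge> N" "x \<in> ball z s" for m x v
      proof (rule tendsto_upperbound)
        show "((\<lambda>n. norm (D m x v - D n x v)) \<longlongrightarrow> norm (D m x v - D' x v)) sequentially"
          by (intro tendsto_intros D' that)
        show "\<forall>\<^sub>F n in sequentially. norm (D m x v - D n x v) \<le> e * norm v"
          using N that eventually_sequentially by blast
      qed simp
      then show ?thesis unfolding eventually_sequentially by blast
    qed
    show "z \<in> ball z s" using s by simp
    show "(\<lambda>n. F n z) \<longlonglongrightarrow> G z"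
      using tendsto_uniform_limitI[OF lim \<open>z \<in> S\<close>] .
  qed simp
  then obtain g where "\<forall>x\<in>ball z s. (\<lambda>n. F n x) \<longlonglongrightarrow> g x \<and>
      (g has_derivative D' x) (at x within ball z s)"
    by blast
  then have g: "(\<lambda>n. F n x) \<longlonglongrightarrow> g x" "(g has_derivative D' x) (at x within ball z s)"
    if "x \<in> ball z s" for x
    using that by auto
  have gG: "g x = G x" if "x \<in> ball z s" for x
    using LIMSEQ_unique[OF g(1)[OF that] tendsto_uniform_limitI[OF lim inS[OF that]]] .
  have "(g has_derivative D' z) (at z)"
    using g(2)[of z] s by (simp add: at_within_open[of z "ball z s"])
  then have "(G has_derivative D' z) (at z)"
    by (rule has_derivative_transform_within_open[of _ _ _ UNIV "ball z s", simplified]) (use s gG in auto)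
  moreover have "D' z (c *s v) = c * D' z v" for c v
  proof (rule LIMSEQ_unique)
    show "(\<lambda>n. D n z (c *s v)) \<longlonglongrightarrow> D' z (c *s v)" using D' s by simp
    show "(\<lambda>n. D n z (c *s v)) \<longlonglongrightarrow> c * D' z v"
      using D'[of z v] s D(2)[OF \<open>z \<in> S\<close>] by (auto intro: tendsto_intros)
  qed
  ultimately show "\<exists>D. (G has_derivative D) (at z) \<and> (\<forall>c v. D (c *s v) = c * D v)"
    by blast
qed

section \<open>Coordinate slices and separate continuity\<close>

text \<open>
  Separate continuity and holomorphy say something about \<open>w \<mapsto> F (slice z i w)\<close>, the restriction of
  a function to the complex line through \<open>z\<close> in the \<open>i\<close>-th coordinate direction.
\<close>

definition slice :: "complex^'n \<Rightarrow> 'n \<Rightarrow> complex \<Rightarrow> complex^'n" where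
  "slice z i w = (\<chi> j. if j = i then w else z $ j)"

lemma slice_self [simp]: "slice z i (z $ i) = z"
  by (simp add: slice_def vec_eq_iff)

lemma slice_nth [simp]: "slice z i w $ i = w"
  by (simp add: slice_def)

lemma slice_eq_line: "slice z i w = slice z i 0 + w *s axis i 1"
  by (simp add: slice_def vec_eq_iff axis_def)

lemma continuous_on_slice [continuous_intros]: "continuous_on A (slice z i)"
proof -
  have "slice z i = (\<lambda>w. slice z i 0 + w *s axis i 1)"
    by (rule ext) (rule slice_eq_line)
  moreover have "continuous_on A (\<lambda>w. slice z i 0 + w *s axis i 1)"
    by (intro continuous_intros linear_continuous_on bounded_linear_complex_line)
  ultimately show ?thesis by metis
qed

lemma inner_slice: "slice z i w \<bullet> p = Re (w * cnj (p $ i)) + slice z i 0 \<bullet> p"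
proof -
  have "slice z i w \<bullet> p = (\<Sum>j\<in>UNIV. (if j = i then Re (w * cnj (p $ i)) else 0) + slice z i 0 $ j \<bullet> p $ j)"
    by (simp add: inner_vec_def, intro sum.cong) (auto simp: slice_def inner_complex_def)
  then show ?thesis
    by (simp add: sum.distrib inner_vec_def)
qed

lemma norm_slice: "(norm (slice z i w))\<^sup>2 = (norm w)\<^sup>2 + (norm (slice z i 0))\<^sup>2"
proof -
  have "(norm (slice z i w))\<^sup>2 = (\<Sum>j\<in>UNIV. (if j = i then (norm w)\<^sup>2 else 0) + (norm (slice z i 0 $ j))\<^sup>2)"
    by (simp add: norm_vec_def L2_set_def sum_nonneg, intro sum.cong) (auto simp: slice_def)
  then show ?thesis
    by (simp add: sum.distrib norm_vec_def L2_set_def sum_nonneg)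
qed

lemma holomorphic_on_slice:
  assumes "holomorphic_several_on F S"
  shows "(\<lambda>w. F (slice z i w)) holomorphic_on {w. slice z i w \<in> S}"
  using holomorphic_on_complex_line[OF assms, of "slice z i 0" "axis i 1"]
  unfolding slice_eq_line[symmetric] .

lemma continuous_on_separately_slice:
  assumes "separately_continuous_on S F" "z \<in> S"
  shows "continuous_on {w. slice z i w \<in> S} (\<lambda>w. F (slice z i w))"
  using assms unfolding separately_continuous_on_def slice_def by blast

lemma separately_continuous_on_subset:
  assumes "separately_continuous_on S F" "T \<subseteq> S"
  shows "separately_continuous_on T F"
  unfolding separately_continuous_on_def
proof (intro ballI allI)
  fix z i assume "z \<in> T"
  with assms(2) have "z \<in> S" by blast
  from continuous_on_separately_slice[OF assms(1) this, of i]
  show "continuous_on {w. (\<chi> j. if j = i then w else z $ j) \<in> T} (\<lambda>w. F (\<chi> j. if j = i then w else z $ j))"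
    unfolding slice_def by (rule continuous_on_subset) (use assms(2) in auto)
qed

lemma separately_continuous_on_diff:
  assumes "separately_continuous_on S F" "separately_continuous_on S G"
  shows "separately_continuous_on S (\<lambda>z. F z - G z)"
  using assms unfolding separately_continuous_on_def by (auto intro!: continuous_on_diff)

lemma separately_continuous_on_cmult:
  assumes "separately_continuous_on S F"
  shows "separately_continuous_on S (\<lambda>z. a * F z)"
  using assms unfolding separately_continuous_on_def by (auto intro!: continuous_on_mult_left)

lemma continuous_on_imp_separately:
  assumes "continuous_on S F"
  shows "separately_continuous_on S F"
  unfolding separately_continuous_on_def
proof (intro ballI allI)
  fix z i
  have "continuous_on {w. slice z i w \<in> S} (\<lambda>w. F (slice z i w))"
    by (rule continuous_on_compose2[OF assms continuous_on_slice]) auto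
  then show "continuous_on {w. (\<chi> j. if j = i then w else z $ j) \<in> S} (\<lambda>w. F (\<chi> j. if j = i then w else z $ j))"
    unfolding slice_def .
qed

lemma separately_continuous_uniform_limit:
  assumes F: "\<And>n. separately_continuous_on S (F n)" and lim: "uniform_limit S F G sequentially"
  shows "separately_continuous_on S G"
  unfolding separately_continuous_on_def
proof (intro ballI allI)
  fix z i assume z: "z \<in> S"
  have "continuous_on {w. slice z i w \<in> S} (\<lambda>w. G (slice z i w))"
  proof (rule uniform_limit_theorem)
    show "uniform_limit {w. slice z i w \<in> S} (\<lambda>n w. F n (slice z i w)) (\<lambda>w. G (slice z i w)) sequentially"
      using lim by (rule uniform_limit_compose') auto
    show "\<forall>\<^sub>F n in sequentially. continuous_on {w. slice z i w \<in> S} (\<lambda>w. F n (slice z i w))"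
      using continuous_on_separately_slice[OF F z] by simp
  qed simp
  then show "continuous_on {w. (\<chi> j. if j = i then w else z $ j) \<in> S} (\<lambda>w. G (\<chi> j. if j = i then w else z $ j))"
    unfolding slice_def .
qed

section \<open>A maximum principle on caps of the ball\<close>

text \<open>
  The inner product is the real one, \<open>z \<bullet> p = Re (\<Sum>j. z\<^sub>j cnj p\<^sub>j)\<close>, so that for a unit vector \<open>p\<close> and
  \<open>c\<close> slightly below \<open>1\<close> the half-space cuts a small cap with pole \<open>p\<close> off the ball. Half-spaces are
  preferred to balls around \<open>p\<close> because \<open>z \<bullet> p\<close> is the real part of a holomorphic function.
\<close>

definition cap :: "complex^'n \<Rightarrow> real \<Rightarrow> (complex^'n) set" where
  "cap p c = {z. c < z \<bullet> p}"

definition cap_domain :: "complex^'n \<Rightarrow> real \<Rightarrow> (complex^'n) set" where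
  "cap_domain p c = (cap p c \<inter> ball 0 1) \<union> sphere 0 1"

lemma open_cap [simp]: "open (cap p c)"
  unfolding cap_def by (intro open_Collect_less continuous_intros)

lemma cap_mono: "c \<le> c' \<Longrightarrow> cap p c' \<subseteq> cap p c"
  by (auto simp: cap_def)

lemma cap_domain_mono: "c \<le> c' \<Longrightarrow> cap_domain p c' \<subseteq> cap_domain p c"
  by (auto simp: cap_domain_def cap_def)

lemma dist_cap:
  fixes p :: "complex^'n"
  assumes "norm p = 1" "norm z \<le> 1"
  shows "(dist p z)\<^sup>2 \<le> 2 - 2 * (z \<bullet> p)"
proof -
  have "(dist p z)\<^sup>2 = (norm p)\<^sup>2 + (norm z)\<^sup>2 - 2 * (z \<bullet> p)"
    by (simp add: dist_norm power2_norm_eq_inner inner_diff inner_commute)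
  moreover have "(norm z)\<^sup>2 \<le> 1" using assms(2) by (simp add: power_le_one)
  ultimately show ?thesis using assms(1) by simp
qed

lemma cap_subset_ball:
  fixes p :: "complex^'n"
  assumes "norm p = 1" "r > 0"
  shows "cap p (1 - r\<^sup>2 / 2) \<inter> cball 0 1 \<subseteq> ball p r"
proof
  fix z assume z: "z \<in> cap p (1 - r\<^sup>2 / 2) \<inter> cball 0 1"
  then have "(dist p z)\<^sup>2 < r\<^sup>2" using dist_cap[OF assms(1), of z] by (auto simp: cap_def)
  then show "z \<in> ball p r" using \<open>r > 0\<close> by (simp add: power2_less_imp_less)
qed

text \<open>
  The maximum principle with a weight, which plays the role of the two-constants theorem. Put
  \<open>\<phi> z = (\<Sum>j. z\<^sub>j cnj p\<^sub>j) - a\<close>, so that \<open>Re (\<phi> z) = z \<bullet> p - a\<close>, and multiply \<open>h\<close> by \<open>exp (N * \<phi> z)\<close>.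
  On the flat part \<open>z \<bullet> p = a\<close> of the boundary of the cap the weight has modulus \<open>1\<close>, on the spherical
  part it is at most \<open>exp (N * (1 - a))\<close>. Well inside the cap, division by the weight gains the factor
  \<open>exp (- N * (z \<bullet> p - a))\<close>. So if \<open>N\<close> is chosen large first and then \<open>\<epsilon>\<close> small, \<open>h\<close> is small on the
  smaller caps, whatever the bound \<open>M\<close>.

  As \<open>h\<close> is only separately continuous up to the sphere, the maximum principle is applied on the slice of
  the cap through \<open>z\<close> in one coordinate direction. Each boundary point of this slice lies on the sphere
  or on the flat part.
\<close>

lemma cap_estimate:
  fixes h :: "complex^'n \<Rightarrow> complex"
  assumes p: "norm p = 1" and "c < a" and N: "N \<ge> 0"
    and sep: "separately_continuous_on (cap_domain p c) h"
    and hol: "holomorphic_several_on h (cap p c \<inter> ball 0 1)"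
    and M: "\<And>z. z \<in> cap_domain p c \<Longrightarrow> norm (h z) \<le> M"
    and \<epsilon>: "\<And>z. z \<in> sphere 0 1 \<Longrightarrow> a \<le> z \<bullet> p \<Longrightarrow> norm (h z) \<le> \<epsilon>"
    and z: "norm z \<le> 1" "a \<le> z \<bullet> p"
  shows "norm (h z) \<le> exp (- N * (z \<bullet> p - a)) * max M (\<epsilon> * exp (N * (1 - a)))"
proof -
  \<comment> \<open>Any coordinate will do.\<close>
  obtain i :: 'n where True by simp
  define K where "K = {w. slice z i w \<in> cball 0 1 \<and> a \<le> slice z i w \<bullet> p}"
  have zS: "z \<in> cap_domain p c"
    using z \<open>c < a\<close> by (auto simp: cap_domain_def cap_def)
  have KS: "K \<subseteq> {w. slice z i w \<in> cap_domain p c}"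
    using \<open>c < a\<close> by (auto simp: K_def cap_domain_def cap_def)
  define R where "R = sqrt (1 - (norm (slice z i 0))\<^sup>2)"
  have KR: "K \<subseteq> cball 0 R"
  proof
    fix w assume "w \<in> K"
    then have "(norm (slice z i w))\<^sup>2 \<le> 1" by (simp add: K_def power_le_one)
    then show "w \<in> cball 0 R" by (simp add: norm_slice[of z i w] R_def real_le_rsqrt)
  qed
  have "closed K"
    unfolding K_def mem_cball dist_norm
    by (intro closed_Collect_conj closed_Collect_le continuous_intros)
  have "bounded K" using KR bounded_subset bounded_cball by blast
  \<comment> \<open>The slice lies in the closed disc of radius \<open>R\<close>, hence its interior in the open one.\<close>
  have int: "slice z i w \<in> cap p c \<inter> ball 0 1" if w: "w \<in> interior K" for w
  proof -
    have "w \<in> ball 0 R"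
      using w interior_mono[OF KR] by (auto simp: interior_cball)
    then have "norm w < R" by simp
    then have "norm w < R" by simp
    moreover from this have "0 < 1 - (norm (slice z i 0))\<^sup>2"
      unfolding R_def by (metis norm_ge_zero order_le_less_trans real_sqrt_gt_0_iff)
    ultimately have "(norm w)\<^sup>2 < 1 - (norm (slice z i 0))\<^sup>2"
      unfolding R_def by (metis norm_ge_zero less_eq_real_def power_strict_mono real_sqrt_pow2 zero_less_numeral)
    then have "(norm (slice z i w))\<^sup>2 < 1\<^sup>2" using norm_slice[of z i w] by simp
    then have "norm (slice z i w) < 1" by (rule power2_less_imp_less) simp
    moreover have "w \<in> K" using w interior_subset by blast
    ultimately show ?thesis using \<open>c < a\<close> by (auto simp: K_def cap_def)
  qed
  define g where "g = (\<lambda>w. h (slice z i w) * exp (of_real N * (w * cnj (p $ i) + of_real (slice z i 0 \<bullet> p - a))))"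
  have norm_g: "norm (g w) = norm (h (slice z i w)) * exp (N * (slice z i w \<bullet> p - a))" for w
    by (simp add: g_def norm_mult inner_slice[of z i w])
  have "norm (g (z $ i)) \<le> max M (\<epsilon> * exp (N * (1 - a)))"
  proof (rule maximum_modulus_frontier[where f = g and S = K])
    have "(\<lambda>w. h (slice z i w)) holomorphic_on interior K"
      using holomorphic_on_slice[OF hol, of z i] by (rule holomorphic_on_subset) (use int in auto)
    then show "g holomorphic_on interior K"
      unfolding g_def by (intro holomorphic_intros)
    have "continuous_on K (\<lambda>w. h (slice z i w))"
      using continuous_on_separately_slice[OF sep zS] KS by (rule continuous_on_subset)
    then show "continuous_on (closure K) g"
      unfolding g_def using \<open>closed K\<close> by (auto simp: closure_closed intro!: continuous_intros)
    show "bounded K" by fact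
    show "z $ i \<in> K" using z by (simp add: K_def)
    fix w assume w: "w \<in> frontier K"
    then have "w \<in> K" using \<open>closed K\<close> frontier_subset_closed by blast
    then have wK: "norm (slice z i w) \<le> 1" "a \<le> slice z i w \<bullet> p" by (auto simp: K_def)
    show "norm (g w) \<le> max M (\<epsilon> * exp (N * (1 - a)))"
    proof (cases "norm (slice z i w) = 1")
      case True
      have "slice z i w \<bullet> p \<le> 1"
        using norm_cauchy_schwarz[of "slice z i w" p] True p by simp
      then have "exp (N * (slice z i w \<bullet> p - a)) \<le> exp (N * (1 - a))"
        using N by (simp add: mult_left_mono)
      moreover have le: "norm (h (slice z i w)) \<le> \<epsilon>" using \<epsilon> True wK by simp
      ultimately have "norm (g w) \<le> \<epsilon> * exp (N * (1 - a))"
        unfolding norm_g by (intro mult_mono) (auto intro: order_trans[OF norm_ge_zero le])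
      then show ?thesis by simp
    next
      case False
      have "slice z i w \<bullet> p = a"
      proof (rule ccontr)
        assume "slice z i w \<bullet> p \<noteq> a"
        let ?O = "{w. norm (slice z i w) < 1} \<inter> {w. a < slice z i w \<bullet> p}"
        have "w \<in> ?O" using wK False \<open>slice z i w \<bullet> p \<noteq> a\<close> by auto
        moreover have "open ?O"
          by (intro open_Int open_Collect_less continuous_intros)
        moreover have "?O \<subseteq> K" by (auto simp: K_def)
        ultimately have "w \<in> interior K" using interiorI by blast
        with w show False by (simp add: frontier_def)
      qed
      then have "norm (g w) = norm (h (slice z i w))" by (simp add: norm_g)
      also have "\<dots> \<le> M" using M KS \<open>w \<in> K\<close> by blast
      finally show ?thesis by simp
    qed
  qed
  then have "exp (- N * (z \<bullet> p - a)) * norm (g (z $ i)) \<le> exp (- N * (z \<bullet> p - a)) * max M (\<epsilon> * exp (N * (1 - a)))"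
    by (intro mult_left_mono) auto
  moreover have "exp (- N * (z \<bullet> p - a)) * norm (g (z $ i)) = norm (h z)"
    by (simp add: norm_g exp_minus)
  ultimately show ?thesis by metis
qed

text \<open>
  With vanishing values on the spherical part the estimate holds with \<open>\<epsilon> = 0\<close>, and \<open>N\<close> may tend to
  infinity.
\<close>

lemma cap_uniqueness:
  fixes h :: "complex^'n \<Rightarrow> complex"
  assumes p: "norm p = 1"
    and sep: "separately_continuous_on (cap_domain p c) h"
    and hol: "holomorphic_several_on h (cap p c \<inter> ball 0 1)"
    and M: "\<And>z. z \<in> cap_domain p c \<Longrightarrow> norm (h z) \<le> M"
    and zero: "\<And>z. z \<in> sphere 0 1 \<Longrightarrow> z \<in> cap p c \<Longrightarrow> h z = 0"
    and z: "norm z \<le> 1" "z \<in> cap p c"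
  shows "h z = 0"
proof -
  obtain a where a: "c < a" "a < z \<bullet> p"
    using z dense unfolding cap_def by blast
  have "((\<lambda>N. exp (- N * (z \<bullet> p - a)) * max M 0) \<longlongrightarrow> 0) at_top"
    using a by real_asymp
  then have "norm (h z) \<le> 0"
  proof (rule tendsto_lowerbound)
    show "\<forall>\<^sub>F N in at_top. norm (h z) \<le> exp (- N * (z \<bullet> p - a)) * max M 0"
      using eventually_ge_at_top[of 0]
    proof eventually_elim
      case (elim N)
      have "norm (h z) \<le> exp (- N * (z \<bullet> p - a)) * max M (0 * exp (N * (1 - a)))"
        by (rule cap_estimate[OF p a(1) elim sep hol M])
           (use zero a z in \<open>auto simp: cap_def\<close>)
      then show ?case by simp
    qed
  qed simp
  then show ?thesis by simp
qed

section \<open>A boundary function that does not extend to a given cap\<close>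

text \<open>
  On the circle through \<open>p\<close> in the \<open>i\<close>-th coordinate direction this function is
  \<open>cis \<theta> * p\<^sub>i \<mapsto> max 0 (norm p\<^sub>i ^ 2 * sin \<theta>)\<close>: it vanishes on one side of \<open>p\<close> and not on the other.
\<close>

definition witness :: "complex^'n \<Rightarrow> 'n \<Rightarrow> complex^'n \<Rightarrow> complex" where
  "witness p i z = of_real (max 0 (Im (z $ i * cnj (p $ i))))"

lemma norm_witness_le:
  fixes p :: "complex^'n"
  assumes "norm p = 1" "norm z = 1"
  shows "norm (witness p i z) \<le> 1"
proof -
  have "\<bar>Im (z $ i * cnj (p $ i))\<bar> \<le> norm (z $ i * cnj (p $ i))" by (rule abs_Im_le_cmod)
  also have "\<dots> \<le> 1 * 1"
    unfolding norm_mult complex_mod_cnj using assms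
    by (intro mult_mono) (use Finite_Cartesian_Product.norm_nth_le[of z i] Finite_Cartesian_Product.norm_nth_le[of p i] in auto)
  finally show ?thesis by (simp add: witness_def)
qed

lemma convex_slice_vimage:
  assumes "convex A"
  shows "convex {w. slice z i w \<in> A}"
proof (rule convexI)
  fix x y :: complex and u v :: real
  assume *: "x \<in> {w. slice z i w \<in> A}" "y \<in> {w. slice z i w \<in> A}" "0 \<le> u" "0 \<le> v" "u + v = 1"
  have "slice z i (u *\<^sub>R x + v *\<^sub>R y) = u *\<^sub>R slice z i x + v *\<^sub>R slice z i y"
    using \<open>u + v = 1\<close> by (simp add: vec_eq_iff slice_def flip: scaleR_left_distrib)
  also have "\<dots> \<in> A" using * assms by (auto intro: convexD)
  finally show "u *\<^sub>R x + v *\<^sub>R y \<in> {w. slice z i w \<in> A}" by simp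
qed

lemma open_slice_vimage: "open A \<Longrightarrow> open {w. slice z i w \<in> A}"
  using open_vimage[of A "slice z i"] continuous_on_slice[of UNIV z i] by (simp add: vimage_def)

lemma convex_cap: "convex (cap p c)"
  using convex_halfspace_gt[of c p] by (simp add: cap_def inner_commute)

text \<open>
  The slice of the ball through \<open>p\<close> is the disc of radius \<open>norm (p $ i)\<close>; this lemma and the next one
  approach a point of the boundary circle along its radius.
\<close>

lemma radial_approach:
  fixes p :: "complex^'n"
  assumes "norm p = 1" "p $ i \<noteq> 0" "norm w = norm (p $ i)"
  shows "norm (slice p i w) = 1"
    and "\<And>t. 0 \<le> t \<Longrightarrow> t < 1 \<Longrightarrow> norm (slice p i (of_real t * w)) < 1"
proof -
  have p0: "(norm (slice p i 0))\<^sup>2 = 1 - (norm (p $ i))\<^sup>2"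
    using norm_slice[of p i "p $ i"] assms(1) by simp
  have "(norm (slice p i w))\<^sup>2 = 1"
    using norm_slice[of p i w] assms(3) p0 by simp
  then show "norm (slice p i w) = 1"
    by (metis norm_ge_zero one_power2 power2_eq_imp_eq zero_le_one)
  show "norm (slice p i (of_real t * w)) < 1" if "0 \<le> t" "t < 1" for t
  proof -
    have "t\<^sup>2 < 1\<^sup>2" using that by (intro power_strict_mono) auto
    then have "t\<^sup>2 * (norm (p $ i))\<^sup>2 < 1 * (norm (p $ i))\<^sup>2"
      using assms(2) by (intro mult_strict_right_mono) auto
    then have "(norm (slice p i (of_real t * w)))\<^sup>2 < 1\<^sup>2"
      using norm_slice[of p i "of_real t * w"] assms(3) p0 by (simp add: norm_mult power_mult_distrib)
    then show ?thesis by (rule power2_less_imp_less) simp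
  qed
qed

lemma eventually_radial:
  fixes p :: "complex^'n"
  assumes "norm p = 1" "p $ i \<noteq> 0" "norm w = norm (p $ i)" "slice p i w \<in> A" "open A"
  shows "eventually (\<lambda>t. slice p i (of_real t * w) \<in> A \<inter> ball 0 1) (at_left 1)"
proof -
  have "isCont (slice p i) (of_real 1 * w)"
    using continuous_on_slice[of UNIV p i] continuous_on_eq_continuous_at open_UNIV by blast
  then have "isCont (\<lambda>t. slice p i (of_real t * w)) (1 :: real)"
    by (intro isCont_o2[of "1 :: real" "\<lambda>t. of_real t * w" "slice p i"]) auto
  then have "((\<lambda>t. slice p i (of_real t * w)) \<longlongrightarrow> slice p i w) (at_left (1::real))"
    by (simp add: isCont_def filterlim_at_split)
  then have "eventually (\<lambda>t. slice p i (of_real t * w) \<in> A) (at_left (1::real))"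
    using assms(4,5) by (simp add: tendsto_def)
  moreover have "eventually (\<lambda>t::real. t \<in> {0<..<1}) (at_left 1)"
    by (intro eventually_at_leftI[of 0]) auto
  ultimately show ?thesis
    by eventually_elim (use radial_approach(2)[OF assms(1-3)] in auto)
qed

text \<open>
  Suppose that \<open>F\<close> extends the witness. Near the boundary point \<open>q\<close>, on the side of \<open>p\<close> where the witness
  vanishes, \<open>F\<close> is zero on a small cap by \<open>cap_uniqueness\<close>. By the identity theorem in one variable it
  is zero on the whole slice of the cap at \<open>p\<close>. By continuity along the radius \<open>F\<close> then vanishes at the
  mirror image of \<open>q\<close>, where the witness is positive.
\<close>

lemma witness_not_extendable:
  fixes p :: "complex^'n"
  assumes p: "norm p = 1" "p $ i \<noteq> 0" and "c < 1"
    and sep: "separately_continuous_on (cap_domain p c) F"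
    and hol: "holomorphic_several_on F (cap p c \<inter> ball 0 1)"
    and M: "\<And>z. z \<in> cap_domain p c \<Longrightarrow> norm (F z) \<le> M"
    and F: "\<And>z. z \<in> sphere 0 1 \<Longrightarrow> F z = witness p i z"
  shows False
proof -
  define \<gamma> where "\<gamma> = (\<lambda>\<theta>. p $ i * cis \<theta>)"
  have norm_\<gamma>: "norm (\<gamma> \<theta>) = norm (p $ i)" for \<theta> by (simp add: \<gamma>_def norm_mult)
  have "\<gamma> \<theta> * cnj (p $ i) = of_real ((norm (p $ i))\<^sup>2) * cis \<theta>" for \<theta>
    unfolding \<gamma>_def complex_norm_square by (simp add: ac_simps)
  then have Im_\<gamma>: "Im (\<gamma> \<theta> * cnj (p $ i)) = (norm (p $ i))\<^sup>2 * sin \<theta>"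
    and Re_\<gamma>: "Re (\<gamma> \<theta> * cnj (p $ i)) = (norm (p $ i))\<^sup>2 * cos \<theta>" for \<theta>
    by (simp_all del: of_real_power)
  have inner_\<gamma>: "slice p i (\<gamma> \<theta>) \<bullet> p = (norm (p $ i))\<^sup>2 * cos \<theta> + slice p i 0 \<bullet> p" for \<theta>
    using inner_slice[of p i "\<gamma> \<theta>" p] unfolding Re_\<gamma> .
  obtain \<theta> where \<theta>: "0 < \<theta>" "\<theta> < pi" "c < slice p i (\<gamma> \<theta>) \<bullet> p"
  proof -
    have "slice p i (\<gamma> 0) \<bullet> p = 1"
      using p by (simp add: \<gamma>_def flip: power2_norm_eq_inner)
    then have "((\<lambda>\<theta>. slice p i (\<gamma> \<theta>) \<bullet> p) \<longlongrightarrow> 1) (at_right 0)"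
      unfolding inner_\<gamma> by (auto intro!: tendsto_eq_intros)
    then have "eventually (\<lambda>\<theta>. c < slice p i (\<gamma> \<theta>) \<bullet> p) (at_right 0)"
      using \<open>c < 1\<close> by (rule order_tendstoD)
    moreover have "eventually (\<lambda>\<theta>::real. \<theta> \<in> {0<..<pi}) (at_right 0)"
      by (intro eventually_at_rightI[of 0 pi]) auto
    ultimately have "eventually (\<lambda>\<theta>. 0 < \<theta> \<and> \<theta> < pi \<and> c < slice p i (\<gamma> \<theta>) \<bullet> p) (at_right 0)"
      by eventually_elim auto
    then show thesis using that eventually_happens' trivial_limit_at_right_real by blast
  qed
  \<comment> \<open>The witness is positive at the angle \<open>\<theta>\<close> and vanishes near the angle \<open>-\<theta>\<close>.\<close>
  define q where "q = slice p i (\<gamma> (- \<theta>))"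
  have norm_q: "norm q = 1"
    unfolding q_def by (intro radial_approach p norm_\<gamma>)
  define V where "V = cap p c \<inter> {z. Im (z $ i * cnj (p $ i)) < 0}"
  have "open V"
    unfolding V_def by (intro open_Int open_cap open_Collect_less continuous_intros)
  moreover have "q \<in> V"
    using \<theta> p sin_gt_zero[of \<theta>] Im_\<gamma>[of "- \<theta>"]
    by (simp add: V_def q_def cap_def inner_\<gamma> del: times_complex.sel)
  ultimately obtain r where r: "r > 0" "ball q r \<subseteq> V"
    using openE by blast
  \<comment> \<open>By \<open>cap_subset_ball\<close> this threshold keeps the cap of the ball within \<open>ball q r\<close>.\<close>
  define c' where "c' = 1 - r\<^sup>2 / 2"
  have "c' < 1" using r by (simp add: c'_def)
  have cap_V: "cap q c' \<inter> cball 0 1 \<subseteq> V"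
    using cap_subset_ball[OF norm_q r(1)] r(2) by (auto simp: c'_def)
  have dom: "cap_domain q c' \<subseteq> cap_domain p c" "cap q c' \<inter> ball 0 1 \<subseteq> cap p c \<inter> ball 0 1"
    using cap_V by (auto simp: V_def cap_domain_def)
  have zero: "F z = 0" if "z \<in> cap q c'" "norm z \<le> 1" for z
  proof (rule cap_uniqueness[OF norm_q _ _ _ _ that(2,1)])
    show "separately_continuous_on (cap_domain q c') F"
      using sep dom(1) by (rule separately_continuous_on_subset)
    show "holomorphic_several_on F (cap q c' \<inter> ball 0 1)"
      using hol dom(2) by (rule holomorphic_several_on_subset)
    show "norm (F z) \<le> M" if "z \<in> cap_domain q c'" for z
      using M that dom(1) by blast
    show "F z = 0" if "z \<in> sphere 0 1" "z \<in> cap q c'" for z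
    proof -
      have "z \<in> V" using that cap_V by auto
      then show ?thesis using F[OF that(1)] by (simp add: witness_def V_def)
    qed
  qed
  have slice_zero: "F (slice p i w) = 0" if "slice p i w \<in> cap p c \<inter> ball 0 1" for w
  proof (rule analytic_continuation_open[of "{w. slice p i w \<in> cap q c' \<inter> ball 0 1}"
         "{w. slice p i w \<in> cap p c \<inter> ball 0 1}" "\<lambda>w. F (slice p i w)" "\<lambda>_. 0"])
    show "open {w. slice p i w \<in> cap q c' \<inter> ball 0 1}" "open {w. slice p i w \<in> cap p c \<inter> ball 0 1}"
      by (intro open_slice_vimage open_Int open_cap open_ball)+
    have "slice p i (\<gamma> (- \<theta>)) \<in> cap q c'"
      using norm_q \<open>c' < 1\<close> by (simp add: cap_def flip: q_def power2_norm_eq_inner)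
    from eventually_radial[OF p norm_\<gamma> this open_cap]
    show "{w. slice p i w \<in> cap q c' \<inter> ball 0 1} \<noteq> {}"
      using eventually_happens' trivial_limit_at_left_real by blast
    show "connected {w. slice p i w \<in> cap p c \<inter> ball 0 1}"
      by (intro convex_connected convex_slice_vimage convex_Int convex_cap convex_ball)
    show "(\<lambda>w. F (slice p i w)) holomorphic_on {w. slice p i w \<in> cap p c \<inter> ball 0 1}"
      using hol by (rule holomorphic_on_slice)
  qed (use that dom(2) zero in auto)
  have "slice p i (\<gamma> \<theta>) \<in> cap p c" using \<theta> by (simp add: cap_def)
  from eventually_radial[OF p norm_\<gamma> this open_cap]
  have ev: "eventually (\<lambda>t. slice p i (of_real t * \<gamma> \<theta>) \<in> cap p c \<inter> ball 0 1) (at_left (1::real))" .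
  have q': "slice p i (\<gamma> \<theta>) \<in> sphere 0 1"
    using radial_approach(1)[OF p norm_\<gamma>] by simp
  have "p \<in> cap_domain p c" using p by (simp add: cap_domain_def)
  from continuous_on_separately_slice[OF sep this, of i]
  have "((\<lambda>w. F (slice p i w)) \<longlongrightarrow> F (slice p i (\<gamma> \<theta>))) (at (\<gamma> \<theta>) within {w. slice p i w \<in> cap_domain p c})"
    using q' unfolding continuous_on_def by (simp add: cap_domain_def)
  moreover have "filterlim (\<lambda>t. of_real t * \<gamma> \<theta>) (at (\<gamma> \<theta>) within {w. slice p i w \<in> cap_domain p c}) (at_left (1::real))"
    unfolding filterlim_at
  proof
    have "((\<lambda>t. of_real t * \<gamma> \<theta>) \<longlongrightarrow> of_real 1 * \<gamma> \<theta>) (at_left (1::real))"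
      by (intro tendsto_intros)
    then show "((\<lambda>t. of_real t * \<gamma> \<theta>) \<longlongrightarrow> \<gamma> \<theta>) (at_left (1::real))" by simp
    have "eventually (\<lambda>t::real. t < 1) (at_left 1)"
      by (simp add: eventually_at_filter)
    with ev show "eventually (\<lambda>t. of_real t * \<gamma> \<theta> \<in> {w. slice p i w \<in> cap_domain p c} \<and> of_real t * \<gamma> \<theta> \<noteq> \<gamma> \<theta>) (at_left (1::real))"
      by eventually_elim (use p norm_\<gamma>[of \<theta>] in \<open>auto simp: cap_domain_def\<close>)
  qed
  ultimately have "((\<lambda>t. F (slice p i (of_real t * \<gamma> \<theta>))) \<longlongrightarrow> F (slice p i (\<gamma> \<theta>))) (at_left (1::real))"
    by (rule filterlim_compose)
  moreover have "((\<lambda>t. F (slice p i (of_real t * \<gamma> \<theta>))) \<longlongrightarrow> 0) (at_left (1::real))"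
    by (rule tendsto_eventually) (use ev in eventually_elim, use slice_zero in blast)
  ultimately have "F (slice p i (\<gamma> \<theta>)) = 0"
    using tendsto_unique trivial_limit_at_left_real by blast
  moreover have "Im (\<gamma> \<theta> * cnj (p $ i)) > 0"
    using Im_\<gamma>[of \<theta>] \<theta> p sin_gt_zero[of \<theta>] by (simp del: times_complex.sel)
  ultimately show False
    using F[OF q'] by (simp add: witness_def)
qed

section \<open>The space of continuous functions on the sphere\<close>

lemma norm_le_mdist:
  fixes f g :: "complex^'n \<Rightarrow> complex"
  assumes "f \<in> mspace sphere_cfunspace" "g \<in> mspace sphere_cfunspace" "z \<in> sphere 0 1"
  shows "norm (f z - g z) \<le> mdist sphere_cfunspace f g"
  using mdist_cfunspace_imp_mdist_le[of f "top_of_set (sphere 0 1)" euclidean_metric g _ z] assms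
  by (simp add: sphere_cfunspace_def dist_norm)

lemma mdist_le:
  fixes f g :: "complex^'n \<Rightarrow> complex"
  assumes "0 \<le> B" "\<And>z. z \<in> sphere 0 1 \<Longrightarrow> norm (f z - g z) \<le> B"
  shows "mdist sphere_cfunspace f g \<le> B"
  unfolding sphere_cfunspace_def
  by (rule mdist_cfunspace_le) (use assms in \<open>auto simp: dist_norm\<close>)

lemma completely_metrizable_sphere_cfunspace:
  "completely_metrizable_space (mtopology_of (sphere_cfunspace :: (complex^'n \<Rightarrow> complex) metric))"
proof -
  have "Metric_space.mcomplete (UNIV :: complex set) dist"
    unfolding Met_TC.mcomplete_def using Cauchy_convergent_iff convergent_def by auto
  from Met_TC.mcomplete_cfunspace[OF this]
  have "mcomplete_of (sphere_cfunspace :: (complex^'n \<Rightarrow> complex) metric)"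
    by (simp add: sphere_cfunspace_def euclidean_metric_def Met_TC.Self_def)
  then show ?thesis
    unfolding mcomplete_of_def mtopology_of_def
    using Metric_space.completely_metrizable_space_mtopology Metric_space_mspace_mdist by blast
qed

section \<open>Baire category for graded regularity conditions\<close>

text \<open>As the thresholds increase to \<open>1\<close>, the caps shrink to their pole.\<close>

definition level :: "nat \<Rightarrow> real" where
  "level k = 1 - inverse (real (Suc k))"

lemma level_less: "level k < 1"
  by (simp add: level_def)

text \<open>
  Separately continuous and Lipschitz extendability are treated together. In both cases the regularity
  condition \<open>R\<close> is, on subsets of the closed ball, the increasing union of conditions \<open>Q M\<close>, indexed by a
  bound \<open>M\<close> for the modulus (and for the Lipschitz constant), each of which is closed under uniform limits.
\<close>

locale graded_regularity =
  fixes R :: "(complex^'n) set \<Rightarrow> (complex^'n \<Rightarrow> complex) \<Rightarrow> bool"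
    and Q :: "real \<Rightarrow> (complex^'n) set \<Rightarrow> (complex^'n \<Rightarrow> complex) \<Rightarrow> bool"
  assumes graded: "S \<subseteq> cball 0 1 \<Longrightarrow> R S F \<longleftrightarrow> (\<exists>M. Q M S F)"
    and norm_le: "Q M S F \<Longrightarrow> z \<in> S \<Longrightarrow> norm (F z) \<le> M"
    and separately: "Q M S F \<Longrightarrow> separately_continuous_on S F"
    and mono: "Q M S F \<Longrightarrow> M \<le> M' \<Longrightarrow> T \<subseteq> S \<Longrightarrow> Q M' T F"
    and uniform_limit: "(\<And>n. Q M S (Fs n)) \<Longrightarrow> uniform_limit S Fs F sequentially \<Longrightarrow> Q M S F"
begin

text \<open>
  The extendable functions are a countable union of these sets. The sets need not be closed, but only a
  slightly smaller cap is lost in their closure, which does no harm in the union.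
\<close>

definition extendable_to_cap :: "complex^'n \<Rightarrow> real \<Rightarrow> real \<Rightarrow> (complex^'n \<Rightarrow> complex) set" where
  "extendable_to_cap p c M = {f \<in> mspace sphere_cfunspace. \<exists>F. Q M (cap_domain p c) F \<and>
     holomorphic_several_on F (cap p c \<inter> ball 0 1) \<and> (\<forall>z\<in>sphere 0 1. F z = f z)}"

text \<open>
  If \<open>f\<^sub>n\<close> converges to \<open>f\<close> uniformly on the sphere and \<open>F\<^sub>n\<close> extends \<open>f\<^sub>n\<close> with the common bound \<open>M\<close>, then
  \<open>cap_estimate\<close> for \<open>F\<^sub>m - F\<^sub>n\<close> makes the extensions uniformly Cauchy on the smaller cap. Their limit
  extends \<open>f\<close> there, is holomorphic by Weierstrass' theorem and inherits \<open>Q M\<close>.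
\<close>

lemma closure_extendable_to_cap:
  assumes p: "norm p = 1" and c: "c < c'" "c' < 1"
  shows "mtopology_of sphere_cfunspace closure_of extendable_to_cap p c M \<subseteq> extendable_to_cap p c' M"
proof
  interpret S: Metric_space "mspace sphere_cfunspace" "mdist (sphere_cfunspace :: (complex^'n \<Rightarrow> complex) metric)"
    by (rule Metric_space_mspace_mdist)
  fix f assume "f \<in> mtopology_of sphere_cfunspace closure_of extendable_to_cap p c M"
  then have f: "f \<in> mspace sphere_cfunspace"
    and cl: "\<And>r. r > 0 \<Longrightarrow> \<exists>g\<in>extendable_to_cap p c M. g \<in> S.mball f r"
    unfolding mtopology_of_def S.metric_closure_of by auto
  have "\<exists>g F. g \<in> mspace sphere_cfunspace \<and> mdist sphere_cfunspace f g < inverse (real (Suc n)) \<and>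
       Q M (cap_domain p c) F \<and>
       holomorphic_several_on F (cap p c \<inter> ball 0 1) \<and> (\<forall>z\<in>sphere 0 1. F z = g z)" for n
    using cl[of "inverse (real (Suc n))"] unfolding extendable_to_cap_def by auto
  then obtain g F where g: "\<And>n. g n \<in> mspace sphere_cfunspace"
      "\<And>n. mdist sphere_cfunspace f (g n) < inverse (real (Suc n))"
    and F: "\<And>n. Q M (cap_domain p c) (F n)"
      "\<And>n. holomorphic_several_on (F n) (cap p c \<inter> ball 0 1)"
      "\<And>n z. z \<in> sphere 0 1 \<Longrightarrow> F n z = g n z"
    by metis
  have F_f: "norm (F n z - f z) < inverse (real (Suc n))" if "z \<in> sphere 0 1" for n z
    using norm_le_mdist[OF f g(1) that, of n] g(2)[of n] F(3)[OF that, of n]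
    by (simp add: norm_minus_commute)
  have "M \<ge> 0"
    using p by (intro order_trans[OF norm_ge_zero norm_le[OF F(1), of p 0]]) (simp add: cap_domain_def)
  define a where "a = (c + c') / 2"
  have a: "c < a" "a < c'" using c by (auto simp: a_def)
  have "uniformly_Cauchy_on (cap_domain p c') F"
  proof (rule uniformly_Cauchy_onI)
    fix e :: real assume "e > 0"
    have "((\<lambda>N. exp (- N * (c' - a)) * (2 * M)) \<longlongrightarrow> 0) at_top"
      using a by real_asymp
    then have "eventually (\<lambda>N. exp (- N * (c' - a)) * (2 * M) < e) at_top"
      using \<open>e > 0\<close> by (rule order_tendstoD)
    then obtain N where N: "N \<ge> 0" "exp (- N * (c' - a)) * (2 * M) < e"
      using eventually_ge_at_top[of 0] by (metis (mono_tags, lifting) eventually_at_top_linorder linorder_le_cases)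
    \<comment> \<open>\<open>N\<close> makes the contribution of the flat part small, \<open>\<epsilon>\<close> then that of the sphere.\<close>
    define \<epsilon> where "\<epsilon> = e / 2 * exp (- N * (1 - a))"
    have "1 - a > 0" using a c by simp
    have "\<epsilon> > 0" using \<open>e > 0\<close> by (simp add: \<epsilon>_def)
    have "exp (- N * (1 - a)) \<le> 1" using \<open>1 - a > 0\<close> N by simp
    then have "\<epsilon> \<le> e / 2 * 1" unfolding \<epsilon>_def using \<open>e > 0\<close> by (intro mult_left_mono) auto
    then have "\<epsilon> < e" using \<open>e > 0\<close> by simp
    have \<epsilon>_exp: "\<epsilon> * exp (N * (1 - a)) = e / 2"
      by (simp add: \<epsilon>_def flip: exp_add)
    obtain k where k: "inverse (real (Suc k)) < \<epsilon> / 2"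
      using reals_Archimedean[of "\<epsilon> / 2"] \<open>\<epsilon> > 0\<close> by auto
    have sphere: "norm (F m z - F n z) \<le> \<epsilon>" if "m \<ge> k" "n \<ge> k" "z \<in> sphere 0 1" for m n z
    proof -
      have "inverse (real (Suc m)) \<le> inverse (real (Suc k))" "inverse (real (Suc n)) \<le> inverse (real (Suc k))"
        using that by auto
      moreover have "norm (F m z - F n z) \<le> norm (F m z - f z) + norm (F n z - f z)"
        using norm_triangle_ineq4[of "F m z - f z" "F n z - f z"] by simp
      ultimately show ?thesis using F_f[OF that(3), of m] F_f[OF that(3), of n] k by linarith
    qed
    have "norm (F m z - F n z) < e" if mn: "m \<ge> k" "n \<ge> k" and z: "z \<in> cap_domain p c'" for m n z
    proof (cases "z \<in> sphere 0 1")
      case True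
      then show ?thesis using sphere[OF mn] \<open>\<epsilon> < e\<close> by force
    next
      case False
      then have z': "norm z \<le> 1" "c' < z \<bullet> p"
        using z by (auto simp: cap_domain_def cap_def)
      have "norm (F m z - F n z) \<le> exp (- N * (z \<bullet> p - a)) * max (2 * M) (\<epsilon> * exp (N * (1 - a)))"
      proof (rule cap_estimate[OF p \<open>c < a\<close> \<open>N \<ge> 0\<close>])
        show "separately_continuous_on (cap_domain p c) (\<lambda>z. F m z - F n z)"
          by (intro separately_continuous_on_diff separately[OF F(1)])
        show "holomorphic_several_on (\<lambda>z. F m z - F n z) (cap p c \<inter> ball 0 1)"
          by (intro holomorphic_several_on_diff F(2))
        show "norm (F m z - F n z) \<le> 2 * M" if "z \<in> cap_domain p c" for z
          using norm_triangle_ineq4[of "F m z" "F n z"] norm_le[OF F(1) that, of m] norm_le[OF F(1) that, of n]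
          by linarith
      qed (use sphere[OF mn] z' a in auto)
      also have "\<dots> \<le> exp (- N * (c' - a)) * max (2 * M) (\<epsilon> * exp (N * (1 - a)))"
        using N(1) z' \<open>M \<ge> 0\<close> by (intro mult_right_mono) (auto intro: mult_left_mono)
      also have "\<dots> < e"
      proof -
        have "exp (- N * (c' - a)) \<le> 1" using a N by simp
        then have "exp (- N * (c' - a)) * (e / 2) \<le> 1 * (e / 2)"
          using \<open>e > 0\<close> by (intro mult_right_mono) auto
        with \<open>e > 0\<close> have "exp (- N * (c' - a)) * (e / 2) < e" by linarith
        with N(2) show ?thesis unfolding \<epsilon>_exp by (metis max_def)
      qed
      finally show ?thesis .
    qed
    then show "\<exists>M. \<forall>x\<in>cap_domain p c'. \<forall>m\<ge>M. \<forall>n\<ge>M. dist (F m x) (F n x) < e"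
      unfolding dist_norm by blast
  qed
  then obtain G where G: "uniform_limit (cap_domain p c') F G sequentially"
    using uniformly_convergent_eq_Cauchy uniformly_convergent_on_def by blast
  have sub: "cap_domain p c' \<subseteq> cap_domain p c" "cap p c' \<inter> ball 0 1 \<subseteq> cap p c \<inter> ball 0 1"
    using c cap_mono[of c c' p] cap_domain_mono[of c c' p] by auto
  have "Q M (cap_domain p c') G"
    using uniform_limit[OF mono[OF F(1) order_refl sub(1)] G] .
  moreover have "holomorphic_several_on G (cap p c' \<inter> ball 0 1)"
  proof (rule holomorphic_several_uniform_limit)
    show "holomorphic_several_on (F n) (cap p c' \<inter> ball 0 1)" for n
      using F(2) sub(2) by (rule holomorphic_several_on_subset)
    show "uniform_limit (cap p c' \<inter> ball 0 1) F G sequentially"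
      using G by (rule uniform_limit_on_subset) (auto simp: cap_domain_def)
  qed (intro open_Int open_cap open_ball)
  moreover have "G z = f z" if z: "z \<in> sphere 0 1" for z
  proof (rule LIMSEQ_unique)
    show "(\<lambda>n. F n z) \<longlonglongrightarrow> G z"
      using G by (rule tendsto_uniform_limitI) (use z in \<open>simp add: cap_domain_def\<close>)
    have "(\<lambda>n. F n z - f z) \<longlonglongrightarrow> 0"
      using LIMSEQ_inverse_real_of_nat
      by (rule Lim_null_comparison[rotated]) (use F_f[OF z] in \<open>auto intro!: always_eventually less_imp_le\<close>)
    then show "(\<lambda>n. F n z) \<longlonglongrightarrow> f z" by (rule LIM_zero_cancel)
  qed
  ultimately show "f \<in> extendable_to_cap p c' M"
    using f unfolding extendable_to_cap_def by auto
qed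

text \<open>
  Extendability to a given cap, with some bound, is a linear condition on the boundary function. If a ball around \<open>f\<close> consisted
  of extendable functions, then \<open>f\<close> and the sum of \<open>f\<close> and a small multiple of the witness would both be
  extendable, and so would be the witness.
\<close>

lemma interior_extendable_to_cap:
  assumes p: "norm p = 1" and "c < 1"
  shows "mtopology_of sphere_cfunspace interior_of extendable_to_cap p c M = {}"
proof (rule ccontr)
  interpret S: Metric_space "mspace sphere_cfunspace" "mdist (sphere_cfunspace :: (complex^'n \<Rightarrow> complex) metric)"
    by (rule Metric_space_mspace_mdist)
  assume "mtopology_of sphere_cfunspace interior_of extendable_to_cap p c M \<noteq> {}"
  then obtain f r where f: "f \<in> mspace sphere_cfunspace" and r: "r > 0" "S.mball f r \<subseteq> extendable_to_cap p c M"
    unfolding mtopology_of_def S.metric_interior_of by auto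
  have "p \<noteq> 0" using p by auto
  then obtain i where i: "p $ i \<noteq> 0" by (auto simp: vec_eq_iff)
  define g where "g = restrict (\<lambda>z. f z + of_real (r / 2) * witness p i z) (sphere 0 1)"
  have "continuous_on (sphere 0 1) (\<lambda>z. f z + of_real (r / 2) * witness p i z)"
    using f unfolding witness_def mspace_sphere_cfunspace by (auto intro!: continuous_intros)
  then have g: "g \<in> mspace sphere_cfunspace"
    unfolding mspace_sphere_cfunspace g_def by (auto cong: continuous_on_cong_simp)
  have "mdist sphere_cfunspace f g \<le> r / 2"
  proof (rule mdist_le)
    fix z :: "complex^'n" assume z: "z \<in> sphere 0 1"
    have "norm (of_real (r / 2) * witness p i z) \<le> r / 2 * 1"
      unfolding norm_mult using norm_witness_le[OF p, of z i] z r by (intro mult_mono) auto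
    then show "norm (f z - g z) \<le> r / 2"
      using z by (simp add: g_def)
  qed (use r in simp)
  then have "g \<in> extendable_to_cap p c M" "f \<in> extendable_to_cap p c M"
    using r f g by (auto intro!: subsetD[OF r(2)])
  then obtain F G where F: "Q M (cap_domain p c) F" "holomorphic_several_on F (cap p c \<inter> ball 0 1)"
      "\<And>z. z \<in> sphere 0 1 \<Longrightarrow> F z = f z"
    and G: "Q M (cap_domain p c) G" "holomorphic_several_on G (cap p c \<inter> ball 0 1)"
      "\<And>z. z \<in> sphere 0 1 \<Longrightarrow> G z = g z"
    unfolding extendable_to_cap_def by blast
  let ?H = "\<lambda>z. of_real (2 / r) * (G z - F z)"
  show False
  proof (rule witness_not_extendable[OF p i \<open>c < 1\<close>])
    show "separately_continuous_on (cap_domain p c) ?H"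
      by (intro separately_continuous_on_cmult separately_continuous_on_diff separately[OF F(1)] separately[OF G(1)])
    show "holomorphic_several_on ?H (cap p c \<inter> ball 0 1)"
      by (intro holomorphic_several_on_cmult holomorphic_several_on_diff F G)
    show "norm (?H z) \<le> 2 / r * (2 * M)" if "z \<in> cap_domain p c" for z
    proof -
      have "norm (G z - F z) \<le> 2 * M"
        using norm_triangle_ineq4[of "G z" "F z"] norm_le[OF F(1) that] norm_le[OF G(1) that] by linarith
      then show ?thesis
        unfolding norm_mult using r by (intro mult_mono) (auto simp: norm_divide)
    qed
    show "?H z = witness p i z" if "z \<in> sphere 0 1" for z
      using F(3)[OF that] G(3)[OF that] that r by (simp add: g_def)
  qed
qed

lemma one_sided_extendable_of_cap:
  assumes "f \<in> extendable_to_cap p c M" "norm p = 1" "c < 1"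
  shows "one_sided_extendable_with R f p"
proof -
  obtain F where F: "Q M (cap_domain p c) F" "holomorphic_several_on F (cap p c \<inter> ball 0 1)"
      "\<forall>z\<in>sphere 0 1. F z = f z"
    using assms(1) unfolding extendable_to_cap_def by blast
  have "cap_domain p c \<subseteq> cball 0 1" by (auto simp: cap_domain_def)
  with F(1) have "R (cap_domain p c) F" using graded by blast
  moreover have "p \<in> cap p c"
    using assms(2,3) by (simp add: cap_def flip: power2_norm_eq_inner)
  ultimately show ?thesis
    unfolding one_sided_extendable_with_def
    using F(2,3) by (intro exI[of _ "cap p c"] exI[of _ F]) (simp add: cap_domain_def)
qed

text \<open>
  A neighbourhood of \<open>\<zeta>\<close> contains a small cap with pole in the given dense set.
  Hence countably many caps and bounds suffice.
\<close>

lemma cap_of_one_sided_extendable: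
  assumes f: "f \<in> mspace sphere_cfunspace" and ext: "one_sided_extendable_with R f \<zeta>"
    and \<zeta>: "\<zeta> \<in> sphere 0 1" and T: "T \<subseteq> sphere 0 1" "sphere 0 1 \<subseteq> closure T"
  shows "\<exists>p\<in>T. \<exists>k. f \<in> extendable_to_cap p (level k) (real k)"
proof -
  obtain U F where U: "open U" "\<zeta> \<in> U" "R ((U \<inter> ball 0 1) \<union> sphere 0 1) F"
      "holomorphic_several_on F (U \<inter> ball 0 1)" "\<forall>z\<in>sphere 0 1. F z = f z"
    using ext unfolding one_sided_extendable_with_def by blast
  have "(U \<inter> ball 0 1) \<union> sphere 0 1 \<subseteq> cball 0 1" by auto
  with U(3) obtain M where M: "Q M ((U \<inter> ball 0 1) \<union> sphere 0 1) F"
    using graded by blast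
  obtain r where r: "r > 0" "ball \<zeta> r \<subseteq> U" using U openE by blast
  obtain p where p: "p \<in> T" "dist p \<zeta> < r / 2"
    using \<zeta> T r closure_approachable[of \<zeta> T] by (meson half_gt_zero subsetD)
  then have "norm p = 1" using T by auto
  obtain k1 where k1: "inverse (real (Suc k1)) < (r / 2)\<^sup>2 / 2"
    using reals_Archimedean[of "(r / 2)\<^sup>2 / 2"] r by auto
  obtain k2 :: nat where k2: "M \<le> real k2" using real_arch_simple by blast
  define k where "k = max k1 k2"
  have "inverse (real (Suc k)) \<le> inverse (real (Suc k1))"
    by (intro le_imp_inverse_le) (auto simp: k_def)
  with k1 have "1 - (r / 2)\<^sup>2 / 2 \<le> level k" unfolding level_def by linarith
  then have "cap p (level k) \<inter> cball 0 1 \<subseteq> ball p (r / 2)"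
    using cap_subset_ball[OF \<open>norm p = 1\<close>, of "r / 2"] cap_mono[of "1 - (r / 2)\<^sup>2 / 2" "level k" p] r by auto
  also have "\<dots> \<subseteq> U"
  proof
    fix z assume "z \<in> ball p (r / 2)"
    then have "dist \<zeta> z < r" using p(2) dist_triangle[of \<zeta> z p] by (simp add: dist_commute)
    then show "z \<in> U" using r by auto
  qed
  finally have sub: "cap p (level k) \<inter> ball 0 1 \<subseteq> U \<inter> ball 0 1" by auto
  then have "Q (real k) (cap_domain p (level k)) F"
    using k2 by (intro mono[OF M]) (auto simp: k_def cap_domain_def)
  with sub have "f \<in> extendable_to_cap p (level k) (real k)"
    using f U(5) holomorphic_several_on_subset[OF U(4)] unfolding extendable_to_cap_def by blast
  with p show ?thesis by blast
qed

text \<open>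
  The closures of the sets \<open>extendable_to_cap p (level k) k\<close>, with \<open>p\<close> in a countable dense subset of the
  sphere, are closed and lie in sets \<open>extendable_to_cap p c k\<close> with larger \<open>c\<close>. So they consist of functions that
  are extendable somewhere, their interior is empty, and together they exhaust the functions that are
  extendable somewhere. Baire's theorem applies to the complement of their union.
\<close>

theorem dense_gdelta_nowhere_extendable:
  "dense_gdelta_in (mtopology_of sphere_cfunspace) (nowhere_on_sphere (one_sided_extendable_with R))"
proof -
  let ?X = "mtopology_of (sphere_cfunspace :: (complex^'n \<Rightarrow> complex) metric)"
  obtain T :: "(complex^'n) set" where T: "countable T" "T \<subseteq> sphere 0 1" "sphere 0 1 \<subseteq> closure T"
    using separable by blast
  define \<C> where "\<C> = (\<lambda>(p, k). ?X closure_of extendable_to_cap p (level k) (real k)) ` (T \<times> UNIV)"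
  define next_level where "next_level k = (level k + 1) / 2" for k
  have next_level: "level k < next_level k" "next_level k < 1" for k
    using level_less[of k] by (auto simp: next_level_def)
  have closure: "?X closure_of extendable_to_cap p (level k) (real k) \<subseteq> extendable_to_cap p (next_level k) (real k)"
    if "p \<in> T" for p k
    using that T(2) by (intro closure_extendable_to_cap next_level) auto
  have count: "countable \<C>"
    unfolding \<C>_def using T(1) by (intro countable_image countable_SIGMA) auto
  have closed: "closedin ?X A" and int: "?X interior_of A = {}" if A: "A \<in> \<C>" for A
  proof -
    obtain p k where pk: "p \<in> T" "A = ?X closure_of extendable_to_cap p (level k) (real k)"
      using A unfolding \<C>_def by auto
    show "closedin ?X A" using pk by simp
    have "?X interior_of A \<subseteq> ?X interior_of extendable_to_cap p (next_level k) (real k)"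
      unfolding pk(2) using closure[OF pk(1)] by (rule interior_of_mono)
    also have "\<dots> = {}"
      using pk(1) T(2) next_level by (intro interior_extendable_to_cap) auto
    finally show "?X interior_of A = {}" by simp
  qed
  have eq: "nowhere_on_sphere (one_sided_extendable_with R) = topspace ?X - \<Union>\<C>"
  proof (intro equalityI subsetI)
    fix f assume f: "f \<in> nowhere_on_sphere (one_sided_extendable_with R)"
    have "f \<notin> A" if A: "A \<in> \<C>" for A
    proof
      assume "f \<in> A"
      then obtain p k where pk: "p \<in> T" "f \<in> ?X closure_of extendable_to_cap p (level k) (real k)"
        using A unfolding \<C>_def by auto
      then have "f \<in> extendable_to_cap p (next_level k) (real k)"
        using closure by blast
      with pk(1) have "one_sided_extendable_with R f p"
        using T(2) next_level by (intro one_sided_extendable_of_cap) auto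
      with f pk(1) T(2) show False by (auto simp: nowhere_on_sphere_def)
    qed
    with f show "f \<in> topspace ?X - \<Union>\<C>" by (auto simp: nowhere_on_sphere_def)
  next
    fix f assume f: "f \<in> topspace ?X - \<Union>\<C>"
    have "\<not> one_sided_extendable_with R f \<zeta>" if \<zeta>: "\<zeta> \<in> sphere 0 1" for \<zeta>
    proof
      assume ext: "one_sided_extendable_with R f \<zeta>"
      have "f \<in> mspace sphere_cfunspace" using f by simp
      from cap_of_one_sided_extendable[OF this ext \<zeta> T(2,3)] obtain p k where pk: "p \<in> T" "f \<in> extendable_to_cap p (level k) (real k)"
        by blast
      then have "f \<in> ?X closure_of extendable_to_cap p (level k) (real k)"
        using f closure_of_subset_Int[of ?X] by blast
      with pk(1) f show False unfolding \<C>_def by auto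
    qed
    with f show "f \<in> nowhere_on_sphere (one_sided_extendable_with R)"
      by (auto simp: nowhere_on_sphere_def)
  qed
  have "fsigma_in ?X (\<Union>\<C>)"
    using count closed by (intro fsigma_in_Union closed_imp_fsigma_in) auto
  then have "gdelta_in ?X (topspace ?X - \<Union>\<C>)"
    using fsigma_in_gdelta_in by blast
  moreover have "?X interior_of \<Union>\<C> = {}"
    using count closed int completely_metrizable_sphere_cfunspace by (intro Baire_category_alt) auto
  then have "?X closure_of (topspace ?X - \<Union>\<C>) = topspace ?X"
    by (simp only: closure_of_complement Diff_empty)
  ultimately show ?thesis
    unfolding dense_gdelta_in_def dense_in_def eq by blast
qed

end

section \<open>The three notions of extendability\<close>

interpretation bounded_separately: graded_regularity "\<lambda>S F. bounded (F ` S) \<and> separately_continuous_on S F"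
    "\<lambda>M S F. (\<forall>z\<in>S. norm (F z) \<le> M) \<and> separately_continuous_on S F"
proof
  fix S :: "(complex^'n) set" and F :: "nat \<Rightarrow> complex^'n \<Rightarrow> complex" and M G
  assume *: "\<And>n. (\<forall>z\<in>S. norm (F n z) \<le> M) \<and> separately_continuous_on S (F n)" "uniform_limit S F G sequentially"
  have "norm (G z) \<le> M" if "z \<in> S" for z
    using tendsto_norm[OF tendsto_uniform_limitI[OF *(2) that]]
    by (rule tendsto_upperbound) (use * that in auto)
  then show "(\<forall>z\<in>S. norm (G z) \<le> M) \<and> separately_continuous_on S G"
    using separately_continuous_uniform_limit[of S F G] * by blast
qed (auto simp: bounded_iff intro: separately_continuous_on_subset, fastforce+)

interpretation Lipschitz: graded_regularity "\<lambda>S F. \<exists>L. L-lipschitz_on S F"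
    "\<lambda>M S F. (\<forall>z\<in>S. norm (F z) \<le> M) \<and> M-lipschitz_on S F"
proof
  fix S :: "(complex^'n) set" and F :: "complex^'n \<Rightarrow> complex"
  assume S: "S \<subseteq> cball 0 1"
  show "(\<exists>L. L-lipschitz_on S F) \<longleftrightarrow> (\<exists>M. (\<forall>z\<in>S. norm (F z) \<le> M) \<and> M-lipschitz_on S F)"
  proof
    assume "\<exists>L. L-lipschitz_on S F"
    then obtain L where L: "L-lipschitz_on S F" by blast
    have "bounded (F ` S)"
      using L S bounded_subset[OF bounded_cball] lipschitz_on_uniformly_continuous bounded_uniformly_continuous_image by blast
    then obtain B where B: "\<And>z. z \<in> S \<Longrightarrow> norm (F z) \<le> B" unfolding bounded_iff by auto
    have "(max L B)-lipschitz_on S F" using L by (rule lipschitz_on_mono) auto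
    then show "\<exists>M. (\<forall>z\<in>S. norm (F z) \<le> M) \<and> M-lipschitz_on S F"
      using B by (intro exI[of _ "max L B"]) force
  qed blast
next
  fix S :: "(complex^'n) set" and F :: "nat \<Rightarrow> complex^'n \<Rightarrow> complex" and M G
  assume *: "\<And>n. (\<forall>z\<in>S. norm (F n z) \<le> M) \<and> M-lipschitz_on S (F n)" "uniform_limit S F G sequentially"
  note lim = tendsto_uniform_limitI[OF *(2)]
  have "norm (G z) \<le> M" if "z \<in> S" for z
    using tendsto_norm[OF lim[OF that]] by (rule tendsto_upperbound) (use * that in auto)
  moreover have "M-lipschitz_on S G"
  proof (rule lipschitz_onI)
    show "0 \<le> M" using * lipschitz_on_nonneg by blast
    show "dist (G x) (G y) \<le> M * dist x y" if "x \<in> S" "y \<in> S" for x y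
      using tendsto_dist[OF lim[OF that(1)] lim[OF that(2)]]
      by (rule tendsto_upperbound) (use *(1) that in \<open>auto intro!: always_eventually lipschitz_onD\<close>)
  qed
  ultimately show "(\<forall>z\<in>S. norm (G z) \<le> M) \<and> M-lipschitz_on S G" by blast
next
  show "(\<forall>z\<in>S. norm (F z) \<le> M) \<and> M-lipschitz_on S F \<Longrightarrow> separately_continuous_on S F" for M S and F :: "complex^'n \<Rightarrow> complex"
    by (blast intro: continuous_on_imp_separately lipschitz_on_continuous_on)
next
  show "(\<forall>z\<in>S. norm (F z) \<le> M) \<and> M-lipschitz_on S F \<Longrightarrow> M \<le> M' \<Longrightarrow> T \<subseteq> S \<Longrightarrow>
     (\<forall>z\<in>T. norm (F z) \<le> M') \<and> M'-lipschitz_on T F" for M M' S T and F :: "complex^'n \<Rightarrow> complex"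
    by (meson lipschitz_on_mono order_trans subsetD)
qed blast

text \<open>
  Continuity implies separate continuity; boundedness is achieved by replacing the neighbourhood by a ball
  whose closure it contains, as then the domain of the extension is contained in a compact one.
\<close>

lemma one_sided_extendable_imp_separately:
  assumes f: "continuous_on (sphere 0 1) f" and ext: "one_sided_extendable f \<zeta>"
  shows "one_sided_extendable_separately f \<zeta>"
proof -
  obtain U F where U: "open U" "\<zeta> \<in> U" "continuous_on ((U \<inter> ball 0 1) \<union> sphere 0 1) F"
      "holomorphic_several_on F (U \<inter> ball 0 1)" "\<forall>z\<in>sphere 0 1. F z = f z"
    using ext unfolding one_sided_extendable_def one_sided_extendable_with_def by blast
  obtain r where r: "r > 0" "cball \<zeta> r \<subseteq> U" using U open_contains_cball by blast
  let ?K = "(cball \<zeta> r \<inter> cball 0 1) \<union> sphere 0 1"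
  let ?D = "(ball \<zeta> r \<inter> ball 0 1) \<union> sphere 0 1"
  have "cball (0 :: complex^'n) 1 = ball 0 1 \<union> sphere 0 1" by auto
  then have K: "?K \<subseteq> (U \<inter> ball 0 1) \<union> sphere 0 1" using r(2) by blast
  have "compact (F ` ?K)"
    by (intro compact_continuous_image continuous_on_subset[OF U(3) K] compact_Un compact_Int compact_cball compact_sphere)
  moreover have "F ` ?D \<subseteq> F ` ?K" by (intro image_mono) auto
  ultimately have "bounded (F ` ?D)" using bounded_subset compact_imp_bounded by blast
  moreover have "separately_continuous_on ?D F"
    using r(2) by (intro continuous_on_imp_separately continuous_on_subset[OF U(3)]) auto
  moreover have "holomorphic_several_on F (ball \<zeta> r \<inter> ball 0 1)"
    using U(4) by (rule holomorphic_several_on_subset) (use r(2) in auto)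
  ultimately show ?thesis
    unfolding one_sided_extendable_separately_def one_sided_extendable_with_def
    using r(1) U(5) by (intro exI[of _ "ball \<zeta> r"] exI[of _ F]) auto
qed

theorem theorem22:
  shows "dense_gdelta_in (mtopology_of sphere_cfunspace)
           (nowhere_on_sphere one_sided_extendable_separately :: (complex^'n \<Rightarrow> complex) set) \<and>
         residual_in (mtopology_of sphere_cfunspace)
           (nowhere_on_sphere one_sided_extendable :: (complex^'n \<Rightarrow> complex) set) \<and>
         dense_gdelta_in (mtopology_of sphere_cfunspace)
           (nowhere_on_sphere one_sided_extendable_Lipschitz :: (complex^'n \<Rightarrow> complex) set)"
proof (intro conjI)
  show *: "dense_gdelta_in (mtopology_of sphere_cfunspace)
           (nowhere_on_sphere one_sided_extendable_separately :: (complex^'n \<Rightarrow> complex) set)"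
    unfolding one_sided_extendable_separately_def by (rule bounded_separately.dense_gdelta_nowhere_extendable)
  have "nowhere_on_sphere one_sided_extendable_separately
      \<subseteq> (nowhere_on_sphere one_sided_extendable :: (complex^'n \<Rightarrow> complex) set)"
    using one_sided_extendable_imp_separately
    by (auto simp: nowhere_on_sphere_def mspace_sphere_cfunspace)
  with * show "residual_in (mtopology_of sphere_cfunspace)
           (nowhere_on_sphere one_sided_extendable :: (complex^'n \<Rightarrow> complex) set)"
    unfolding residual_in_def by (auto simp: nowhere_on_sphere_def)
  show "dense_gdelta_in (mtopology_of sphere_cfunspace)
           (nowhere_on_sphere one_sided_extendable_Lipschitz :: (complex^'n \<Rightarrow> complex) set)"
    unfolding one_sided_extendable_Lipschitz_def by (rule Lipschitz.dense_gdelta_nowhere_extendable)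
qed

end
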